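(* Let $m\geqslant 2$ be an integer, let $q_1,q_2\equiv 1\pmod m$ be prime powers, and let $\alpha_1,\alpha_2$ be primitive elements of $\operatorname{GF}(q_1)$ and $\operatorname{GF}(q_2)$, respectively. Suppose that $\Gamma_m(\alpha_1,\alpha_2)$ is a Neumaier graph and that both sets of cyclotomic numbers $\{c_m(\alpha_1;i,j): i,j\in\{1,\dots,m\}\}$ and $\{c_m(\alpha_2;i,j): i,j\in\{1,\dots,m\}\}$ are uniform. Then $\Gamma_m(\alpha_1,\alpha_2)$ is strongly regular.
   Context: For a prime power $q\equiv 1\pmod m$ and a primitive element $\alpha$ of $\operatorname{GF}(q)$, $c_m(\alpha;a,b) = |\{\alpha^k+1 : k \equiv a \pmod m\} \cap \{\alpha^k : k \equiv b \pmod m\}|$ (indices mod $m$). The set $\{c_m(\alpha;i,j)\}$ is called uniform if $c_m(\alpha;i,0)=c_m(\alpha;0,i)=c_m(\alpha;i,i)=c_m(\alpha;0,1)$ for all $i\not\equiv 0$, and $c_m(\alpha;i,j)=c_m(\alpha;1,2)$ for all $i,j$ with $0\ne i\ne j\ne 0$ (mod $m$). Writing $q_i=1+mn_i$, let $\mathsf C_1(\alpha_1) = \{(\alpha_1^k,0): 0\le k\le q_1-2\}$ and $\mathsf D_i(\alpha_1,\alpha_2) = \{(\alpha_1^{i_1},\alpha_2^{i_2}) : i_1-i_2 \equiv i \pmod m\}$ in the additive group $\operatorname{GF}(q_1)\times\operatorname{GF}(q_2)$; $\Gamma_m(\alpha_1,\alpha_2)$ is the Cayley (di)graph on this group with connection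 set $\mathsf C_1(\alpha_1)\cup\mathsf D_0(\alpha_1,\alpha_2)$ (arcs $(g,s+g)$). A Neumaier graph is a non-complete undirected edge-regular graph (regular, every edge in a constant number of triangles) having a clique $C$ such that every vertex outside $C$ is adjacent to exactly $e>0$ vertices of $C$. A graph is strongly regular if it is edge-regular and any two distinct nonadjacent vertices have a constant number of common neighbours. *)

theory Defs
  imports
    "HOL-Library.Product_Plus"
    "HOL-Library.Cardinality"
    "HOL-Number_Theory.Cong"
    "Graph_Theory.Graph_Theory"
begin

text \<open>\<open>GF(q)\<close> is a type \<open>'a\<close> of sort \<open>{field, finite}\<close>, with \<open>q = CARD('a)\<close>.\<close>

definition primitive_element :: "'a::{field,finite} \<Rightarrow> bool" where
  "primitive_element \<alpha> \<longleftrightarrow> range (\<lambda>k::int. \<alpha> powi k) = UNIV - {0}"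

text \<open>Exponents and indices are integers. The cyclotomic classes below consist of
  \<open>(CARD('a) - 1) / m\<close> elements each only if \<open>\<alpha>\<close> is primitive and \<open>m\<close> divides
  \<open>CARD('a) - 1\<close>; both are hypotheses wherever these numbers are used.\<close>

definition cyclotomic_number :: "nat \<Rightarrow> 'a::{field,finite} \<Rightarrow> int \<Rightarrow> int \<Rightarrow> nat" where
  "cyclotomic_number m \<alpha> a b =
     card ({\<alpha> powi k + 1 | k. [k = a] (mod int m)} \<inter> {\<alpha> powi k | k. [k = b] (mod int m)})"

definition uniform_cyclotomic :: "nat \<Rightarrow> 'a::{field,finite} \<Rightarrow> bool" where
  "uniform_cyclotomic m \<alpha> \<longleftrightarrow>
     (\<forall>i. \<not> [i = 0] (mod int m) \<longrightarrow>
        cyclotomic_number m \<alpha> i 0 = cyclotomic_number m \<alpha> 0 i \<and>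
        cyclotomic_number m \<alpha> 0 i = cyclotomic_number m \<alpha> i i \<and>
        cyclotomic_number m \<alpha> i i = cyclotomic_number m \<alpha> 0 1) \<and>
     (\<forall>i j. \<not> [i = 0] (mod int m) \<and> \<not> [i = j] (mod int m) \<and> \<not> [j = 0] (mod int m) \<longrightarrow>
        cyclotomic_number m \<alpha> i j = cyclotomic_number m \<alpha> 1 2)"

definition cayley_digraph :: "'g::group_add set \<Rightarrow> 'g pair_pre_digraph" where
  "cayley_digraph S = \<lparr>pverts = UNIV, parcs = {(g, s + g) | g s. s \<in> S}\<rparr>"

definition C1_set :: "'a::{field,finite} \<Rightarrow> ('a \<times> 'b::{field,finite}) set" where
  "C1_set \<alpha>1 = {(\<alpha>1 ^ k, 0) | k. k \<le> CARD('a) - 2}"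

definition D_set :: "nat \<Rightarrow> int \<Rightarrow> 'a::{field,finite} \<Rightarrow> 'b::{field,finite} \<Rightarrow> ('a \<times> 'b) set" where
  "D_set m i \<alpha>1 \<alpha>2 = {(\<alpha>1 powi i1, \<alpha>2 powi i2) | i1 i2. [i1 - i2 = i] (mod int m)}"

definition Gamma_graph ::
    "nat \<Rightarrow> 'a::{field,finite} \<Rightarrow> 'b::{field,finite} \<Rightarrow> ('a \<times> 'b) pair_pre_digraph" where
  "Gamma_graph m \<alpha>1 \<alpha>2 = cayley_digraph (C1_set \<alpha>1 \<union> D_set m 0 \<alpha>1 \<alpha>2)"

text \<open>The locale \<^locale>\<open>graph\<close> requires a digraph to be finite, simple, loop-free and symmetric,
  i.e. an undirected graph; the degree of a vertex is then its out-degree.\<close>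

definition clique :: "('a, 'b) pre_digraph \<Rightarrow> 'a set \<Rightarrow> bool" where
  "clique G C \<longleftrightarrow> C \<subseteq> verts G \<and> (\<forall>u\<in>C. \<forall>v\<in>C. u \<noteq> v \<longrightarrow> u \<rightarrow>\<^bsub>G\<^esub> v)"

definition edge_regular :: "('a, 'b) pre_digraph \<Rightarrow> bool" where
  "edge_regular G \<longleftrightarrow> graph G \<and>
     (\<exists>k. \<forall>v\<in>verts G. out_degree G v = k) \<and>
     (\<exists>l. \<forall>u v. u \<rightarrow>\<^bsub>G\<^esub> v \<longrightarrow> card {T. clique G T \<and> card T = 3 \<and> u \<in> T \<and> v \<in> T} = l)"

definition neumaier_graph :: "('a, 'b) pre_digraph \<Rightarrow> bool" where
  "neumaier_graph G \<longleftrightarrow> edge_regular G \<and> \<not> complete_digraph (card (verts G)) G \<and>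
     (\<exists>C e. clique G C \<and> e > 0 \<and> (\<forall>v \<in> verts G - C. card {w \<in> C. v \<rightarrow>\<^bsub>G\<^esub> w} = e))"

definition strongly_regular :: "('a, 'b) pre_digraph \<Rightarrow> bool" where
  "strongly_regular G \<longleftrightarrow> edge_regular G \<and>
     (\<exists>\<mu>. \<forall>u\<in>verts G. \<forall>v\<in>verts G. u \<noteq> v \<and> \<not> u \<rightarrow>\<^bsub>G\<^esub> v \<longrightarrow>
        card {w \<in> verts G. u \<rightarrow>\<^bsub>G\<^esub> w \<and> v \<rightarrow>\<^bsub>G\<^esub> w} = \<mu>)"

end

theory Submission
  imports Defs "HOL-Combinatorics.Transposition"
begin

text \<open>Let \<open>N g\<close> be the number of \<open>s \<in> S\<close> with \<open>g - s \<in> S\<close>, where \<open>S\<close> is the connection set;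
  uniformity forces \<open>-1\<close> to be an \<open>m\<close>-th power in both fields, so \<open>S = -S\<close> and \<open>N (v - u)\<close> counts the
  common neighbours of \<open>u\<close> and \<open>v\<close>. Edge-regularity says that \<open>N\<close> is constant on \<open>S\<close>, with a value
  that can be computed at \<open>(u, 0)\<close>. The value \<open>f\<^sub>1 * (f\<^sub>2 + 1)\<close> of \<open>N\<close> at \<open>(0, v)\<close>, where
  \<open>q\<^sub>i = 1 + m * f\<^sub>i\<close>, is elementary. On the remaining differences, the union of the \<open>D\<^sub>i\<close> with
  \<open>i \<noteq> 0\<close>, \<open>N\<close> is constant by uniformity; summing \<open>N\<close> over the whole group to \<open>card S ^ 2\<close> shows
  that this constant is \<open>f\<^sub>1 * (f\<^sub>2 + 1)\<close> too.\<close>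

lemma card_sum_fibres:
  assumes "finite A" "finite I" "f ` A \<subseteq> I"
  shows "card A = (\<Sum>i\<in>I. card {x \<in> A. f x = i})"
  using sum.group[OF assms, of "\<lambda>_. 1::nat"] by simp

section \<open>Primitive elements, discrete logarithms and cyclotomic classes\<close>

locale cyclotomy =
  fixes m :: nat and \<alpha> :: "'a::{field,finite}"
  assumes m_ge_2: "m \<ge> 2"
    and card_cong: "[CARD('a) = 1] (mod m)"
    and prim: "primitive_element \<alpha>"
begin

lemma alpha_nonzero [simp]: "\<alpha> \<noteq> 0"
proof
  assume "\<alpha> = 0"
  then have "0 \<in> range (\<lambda>k::int. \<alpha> powi k)"
    by (intro range_eqI[of _ _ 1]) simp
  then show False
    using prim by (simp add: primitive_element_def)
qed

lemma nonzero_powi: "x \<noteq> 0 \<Longrightarrow> \<exists>k. \<alpha> powi k = x"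
  using prim unfolding primitive_element_def by (metis Diff_iff UNIV_I empty_iff insert_iff rangeE)

lemma card_gt_1: "CARD('a) > 1"
proof -
  have "card {0, 1::'a} \<le> CARD('a)"
    by (intro card_mono) auto
  then show ?thesis by simp
qed

lemma nonzero_eq_power_less:
  assumes "d > 0" "\<alpha> ^ d = 1" "x \<noteq> 0"
  obtains k where "k < d" "x = \<alpha> ^ k"
proof -
  obtain k where k: "\<alpha> powi k = x"
    using nonzero_powi assms by auto
  have "\<alpha> powi k = \<alpha> powi (int d * (k div int d) + k mod int d)"
    by simp
  also have "\<dots> = \<alpha> powi (k mod int d)"
    unfolding power_int_add[OF disjI1[OF alpha_nonzero]] power_int_mult using assms by simp
  also have "\<dots> = \<alpha> ^ nat (k mod int d)"
    using assms by (simp add: power_int_def)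
  finally have "x = \<alpha> ^ nat (k mod int d)"
    using k by simp
  moreover have "nat (k mod int d) < d"
    using assms by (simp add: nat_less_iff)
  ultimately show ?thesis
    using that by blast
qed

text \<open>Once \<open>\<alpha> ^ d = 1\<close>, exponents can be reduced modulo \<open>d\<close>,
  so the powers with exponent below \<open>d\<close> already exhaust the nonzero elements.\<close>

lemma power_eq_1_imp_ge:
  assumes "d > 0" "\<alpha> ^ d = 1"
  shows "CARD('a) - 1 \<le> d"
proof -
  have "UNIV - {0} \<subseteq> (\<lambda>k. \<alpha> ^ k) ` {..<d}"
    using nonzero_eq_power_less[OF assms] by blast
  then have "card (UNIV - {0::'a}) \<le> card ((\<lambda>k. \<alpha> ^ k) ` {..<d})"
    by (intro card_mono) auto
  also have "\<dots> \<le> d"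
    using card_image_le[of "{..<d}" "\<lambda>k. \<alpha> ^ k"] by simp
  finally show ?thesis by simp
qed

text \<open>The pigeonhole principle on the exponents \<open>0\<close> to
  \<open>CARD('a) - 1\<close> yields a period of at most \<open>CARD('a) - 1\<close>, and
  \<open>power_eq_1_imp_ge\<close> excludes any shorter one.\<close>

lemma power_card_minus_1: "\<alpha> ^ (CARD('a) - 1) = 1"
proof -
  let ?N = "CARD('a) - 1"
  have "(\<lambda>k. \<alpha> ^ k) ` {..?N} \<subseteq> UNIV - {0}"
    by auto
  then have "card ((\<lambda>k. \<alpha> ^ k) ` {..?N}) \<le> card (UNIV - {0::'a})"
    by (intro card_mono) auto
  then have "card ((\<lambda>k. \<alpha> ^ k) ` {..?N}) < card {..?N}"
    using card_gt_1 by simp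
  then have "\<not> inj_on (\<lambda>k. \<alpha> ^ k) {..?N}"
    using pigeonhole by blast
  then obtain i j where ij: "i < j" "j \<le> ?N" "\<alpha> ^ i = \<alpha> ^ j"
    by (smt (verit) atMost_iff inj_onI linorder_neqE_nat)
  have "\<alpha> ^ j = \<alpha> ^ i * \<alpha> ^ (j - i)"
    by (subst power_add [symmetric]) (use ij(1) in simp)
  then have *: "\<alpha> ^ (j - i) = 1"
    using ij by simp
  then have "?N \<le> j - i"
    using ij by (intro power_eq_1_imp_ge) auto
  then have "j - i = ?N"
    using ij by linarith
  with * show ?thesis by simp
qed

lemma m_dvd_card: "m dvd CARD('a) - 1"
  using card_cong card_gt_1 by (metis cong_altdef_nat less_imp_le_nat)

text \<open>The order of \<open>\<alpha>\<close> is exactly \<open>CARD('a) - 1\<close>, a multiple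
  of \<open>m\<close>. Hence the exponent of a nonzero element is well defined modulo
  \<open>m\<close>.\<close>

lemma powi_eq_1_imp_dvd:
  assumes "\<alpha> powi d = 1"
  shows "int m dvd d"
proof -
  let ?N = "CARD('a) - 1"
  have N: "?N > 0"
    using card_gt_1 by simp
  have "\<alpha> powi d = \<alpha> powi (int ?N * (d div int ?N) + d mod int ?N)"
    by (simp del: of_nat_diff)
  also have "\<dots> = (\<alpha> ^ ?N) powi (d div int ?N) * \<alpha> powi (d mod int ?N)"
    unfolding power_int_add[OF disjI1[OF alpha_nonzero]] power_int_mult
    by (simp only: power_int_of_nat)
  also have "\<dots> = \<alpha> powi (d mod int ?N)"
    by (simp only: power_card_minus_1) simp
  also have "\<dots> = \<alpha> ^ nat (d mod int ?N)"
    using N by (simp add: power_int_def del: of_nat_diff)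
  finally have *: "\<alpha> ^ nat (d mod int ?N) = 1"
    using assms by simp
  have "nat (d mod int ?N) < ?N"
    using N by (simp add: nat_less_iff del: of_nat_diff)
  then have "nat (d mod int ?N) = 0"
    using power_eq_1_imp_ge[OF _ *] by linarith
  then have "int ?N dvd d"
    using N by (metis mod_0_imp_dvd nat_0_iff of_nat_0_less_iff order_antisym pos_mod_sign)
  moreover have "int m dvd int ?N"
    using m_dvd_card by (simp only: int_dvd_int_iff)
  ultimately show ?thesis
    by (rule dvd_trans[rotated])
qed

text \<open>The discrete logarithm to base \<open>\<alpha>\<close>, kept only modulo
  \<open>m\<close>; by \<open>dlog_powi\<close> the choice of the exponent is then harmless. At
  \<open>0\<close> no exponent exists and the value is an unspecified residue, hence the nonzero
  guards in what follows.\<close>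

definition dlog :: "'a \<Rightarrow> int" where
  "dlog x = (SOME k. \<alpha> powi k = x) mod int m"

lemma dlog_powi [simp]: "dlog (\<alpha> powi k) = k mod int m"
proof -
  define l where "l = (SOME l. \<alpha> powi l = \<alpha> powi k)"
  have "\<alpha> powi l = \<alpha> powi k"
    unfolding l_def by (rule someI) simp
  then have "\<alpha> powi (l - k) = 1"
    by (simp add: power_int_diff)
  then have "int m dvd l - k"
    by (rule powi_eq_1_imp_dvd)
  then show ?thesis
    by (simp add: dlog_def mod_eq_dvd_iff flip: l_def)
qed

definition residues :: "int set" where
  "residues = {0..<int m}"

lemma finite_residues [simp]: "finite residues"
  by (simp add: residues_def)

lemma card_residues [simp]: "card residues = m"
  by (simp add: residues_def)

lemma zero_in_residues [simp]: "0 \<in> residues"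
  using m_ge_2 by (simp add: residues_def)

lemma mod_in_residues [simp]: "k mod int m \<in> residues"
  using m_ge_2 by (simp add: residues_def)

lemma dlog_in_residues [simp]: "dlog x \<in> residues"
  unfolding dlog_def by (rule mod_in_residues)

lemma residues_mod [simp]: "k \<in> residues \<Longrightarrow> k mod int m = k"
  by (simp add: residues_def)

lemma dlog_mod [simp]: "dlog x mod int m = dlog x"
  by simp

lemma residues_cong_iff: "k \<in> residues \<Longrightarrow> l \<in> residues \<Longrightarrow> [k = l] (mod int m) \<longleftrightarrow> k = l"
  by (simp add: cong_def)

lemma dlog_mult: "x \<noteq> 0 \<Longrightarrow> y \<noteq> 0 \<Longrightarrow> dlog (x * y) = (dlog x + dlog y) mod int m"
  by (metis alpha_nonzero dlog_powi mod_add_eq nonzero_powi power_int_add)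

lemma dlog_1 [simp]: "dlog 1 = 0"
  using dlog_powi[of 0] by simp

definition cyc_class :: "int \<Rightarrow> 'a set" where
  "cyc_class k = {x. x \<noteq> 0 \<and> dlog x = k mod int m}"

lemma cyc_class_eq: "cyc_class a = {\<alpha> powi k | k. [k = a] (mod int m)}"
  by (auto simp: cyc_class_def cong_def) (metis dlog_powi nonzero_powi)

text \<open>Counting \<open>z\<close> instead of \<open>z + 1\<close> expresses both class
  conditions through \<open>dlog\<close>.\<close>

lemma cyclotomic_number_alt:
  "cyclotomic_number m \<alpha> a b =
     card {z. z \<noteq> 0 \<and> z + 1 \<noteq> 0 \<and> dlog z = a mod int m \<and> dlog (z + 1) = b mod int m}"
  (is "_ = card ?Z")
proof -
  have "{\<alpha> powi k + 1 | k. [k = a] (mod int m)} = (\<lambda>z. z + 1) ` cyc_class a"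
    by (auto simp: cyc_class_eq)
  then have "{\<alpha> powi k + 1 | k. [k = a] (mod int m)} \<inter> {\<alpha> powi k | k. [k = b] (mod int m)} =
      (\<lambda>z. z + 1) ` ?Z"
    unfolding cyc_class_eq[symmetric] by (auto simp: cyc_class_def)
  then show ?thesis
    by (simp add: cyclotomic_number_def card_image)
qed

lemma cyclotomic_number_cong:
  "[a = a'] (mod int m) \<Longrightarrow> [b = b'] (mod int m) \<Longrightarrow>
    cyclotomic_number m \<alpha> a b = cyclotomic_number m \<alpha> a' b'"
  by (simp add: cyclotomic_number_alt cong_def)

definition f :: nat where "f = card (cyc_class 0)"

text \<open>The classes are the cosets of \<open>cyc_class 0\<close>; multiplication by
  \<open>\<alpha> powi k\<close> carries that class to class \<open>k\<close>.\<close>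

lemma card_cyc_class: "card (cyc_class k) = f"
proof -
  have "bij_betw (\<lambda>x. \<alpha> powi k * x) (cyc_class 0) (cyc_class k)"
  proof (rule bij_betw_byWitness[where f' = "\<lambda>x. \<alpha> powi (-k) * x"])
    have *: "dlog (\<alpha> powi l * x) = (l + dlog x) mod int m" if "x \<noteq> 0" for l x
      using that by (simp add: dlog_mult mod_simps)
    show "(\<lambda>x. \<alpha> powi k * x) ` cyc_class 0 \<subseteq> cyc_class k"
      by (auto simp: cyc_class_def *)
    show "(\<lambda>x. \<alpha> powi (- k) * x) ` cyc_class k \<subseteq> cyc_class 0"
      by (auto simp: cyc_class_def * mod_simps)
  qed (auto simp: power_int_minus)
  then show ?thesis
    by (simp add: f_def bij_betw_same_card)
qed

lemma card_eq: "CARD('a) = 1 + m * f"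
proof -
  have "card (UNIV - {0::'a}) = (\<Sum>k\<in>residues. card {x \<in> UNIV - {0}. dlog x = k})"
    by (rule card_sum_fibres) auto
  also have "\<dots> = (\<Sum>k\<in>residues. f)"
  proof (rule sum.cong[OF refl])
    fix k
    assume "k \<in> residues"
    then show "card {x \<in> UNIV - {0}. dlog x = k} = f"
      using card_cyc_class[of k] by (simp add: cyc_class_def)
  qed
  finally show ?thesis
    using card_gt_1 by simp
qed

lemma f_pos: "f > 0"
  using card_eq card_gt_1 by (cases f) auto

end

section \<open>Consequences of uniformity\<close>

locale uniform_cyclotomy = cyclotomy +
  assumes uniform: "uniform_cyclotomic m \<alpha>"
begin

abbreviation c :: "int \<Rightarrow> int \<Rightarrow> nat" where
  "c i j \<equiv> cyclotomic_number m \<alpha> i j"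

text \<open>A normal form: \<open>c i j\<close> depends only on which of \<open>i\<close>,
  \<open>j\<close> and \<open>0\<close> coincide modulo \<open>m\<close>. Both the symmetry of the
  table and its invariance under permutations of residues are read off from it.\<close>

lemma c_cases:
  "c i j = (if [i = 0] (mod int m) \<and> [j = 0] (mod int m) then c 0 0
     else if [i = 0] (mod int m) \<or> [j = 0] (mod int m) \<or> [i = j] (mod int m) then c 0 1
     else c 1 2)"
proof -
  have u1: "c i 0 = c 0 1" "c 0 i = c 0 1" "c i i = c 0 1" if "\<not> [i = 0] (mod int m)" for i
    using uniform that unfolding uniform_cyclotomic_def by metis+
  have u2: "c i j = c 1 2"
    if "\<not> [i = 0] (mod int m)" "\<not> [i = j] (mod int m)" "\<not> [j = 0] (mod int m)"
    using uniform that unfolding uniform_cyclotomic_def by metis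
  consider "[i = 0] (mod int m)" "[j = 0] (mod int m)"
    | "[i = 0] (mod int m)" "\<not> [j = 0] (mod int m)"
    | "\<not> [i = 0] (mod int m)" "[j = 0] (mod int m)"
    | "\<not> [i = 0] (mod int m)" "\<not> [j = 0] (mod int m)" "[i = j] (mod int m)"
    | "\<not> [i = 0] (mod int m)" "\<not> [j = 0] (mod int m)" "\<not> [i = j] (mod int m)"
    by blast
  then show ?thesis
  proof cases
    case 1
    then show ?thesis using cyclotomic_number_cong[of i 0 j 0] by simp
  next
    case 2
    then show ?thesis using cyclotomic_number_cong[of i 0 j j] u1(2)[of j] by simp
  next
    case 3
    then show ?thesis using cyclotomic_number_cong[of i i j 0] u1(1)[of i] by simp
  next
    case 4
    then show ?thesis
      using cyclotomic_number_cong[of i i j i] u1(3)[of i] by (simp add: cong_sym)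
  next
    case 5
    then show ?thesis using u2 by simp
  qed
qed

lemma c_commute: "c i j = c j i"
  using c_cases[of i j] c_cases[of j i] by (simp add: conj_commute disj_commute cong_sym_eq)

text \<open>If \<open>e = dlog (-1)\<close> were nonzero, row \<open>e\<close> of the table of cyclotomic numbers would sum to
  \<open>f - 1\<close>, as \<open>z = -1\<close> is lost, but column \<open>e\<close> to \<open>f\<close>; yet the table is symmetric.\<close>

lemma dlog_minus_1: "dlog (-1) = 0"
proof (rule ccontr)
  define e where "e = dlog (-1)"
  assume "dlog (-1) \<noteq> 0"
  then have e: "e \<noteq> 0" "e \<in> residues"
    by (auto simp: e_def)
  have "(\<Sum>k\<in>residues. c e k) = card {z. z \<noteq> 0 \<and> z + 1 \<noteq> 0 \<and> dlog z = e}"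
  proof -
    have "card {z. z \<noteq> 0 \<and> z + 1 \<noteq> 0 \<and> dlog z = e} =
        (\<Sum>k\<in>residues. card {z \<in> {z. z \<noteq> 0 \<and> z + 1 \<noteq> 0 \<and> dlog z = e}. dlog (z + 1) = k})"
      by (rule card_sum_fibres) auto
    also have "\<dots> = (\<Sum>k\<in>residues. c e k)"
      using e(2) by (intro sum.cong refl) (simp add: cyclotomic_number_alt conj_assoc)
    finally show ?thesis ..
  qed
  also have "{z. z \<noteq> 0 \<and> z + 1 \<noteq> 0 \<and> dlog z = e} = cyc_class e - {-1}"
    using e(2) by (auto simp: cyc_class_def add_eq_0_iff2)
  also have "card \<dots> = f - 1"
    using e(2) by (subst card_Diff_singleton) (simp_all add: card_cyc_class, simp add: cyc_class_def e_def)
  finally have row: "(\<Sum>k\<in>residues. c e k) = f - 1" .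
  have "(\<Sum>k\<in>residues. c k e) = card {z. z \<noteq> 0 \<and> z + 1 \<noteq> 0 \<and> dlog (z + 1) = e}"
  proof -
    have "card {z. z \<noteq> 0 \<and> z + 1 \<noteq> 0 \<and> dlog (z + 1) = e} =
        (\<Sum>k\<in>residues. card {z \<in> {z. z \<noteq> 0 \<and> z + 1 \<noteq> 0 \<and> dlog (z + 1) = e}. dlog z = k})"
      by (rule card_sum_fibres) auto
    also have "\<dots> = (\<Sum>k\<in>residues. c k e)"
      using e(2) by (intro sum.cong refl) (auto simp: cyclotomic_number_alt intro!: arg_cong[where f = card])
    finally show ?thesis ..
  qed
  also have "\<dots> = card ((\<lambda>x. x - 1) ` cyc_class e)"
  proof (intro arg_cong[where f = card] equalityI subsetI)
    fix z
    assume "z \<in> {z. z \<noteq> 0 \<and> z + 1 \<noteq> 0 \<and> dlog (z + 1) = e}"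
    then show "z \<in> (\<lambda>x. x - 1) ` cyc_class e"
      using e(2) by (intro image_eqI[of _ _ "z + 1"]) (auto simp: cyc_class_def)
  next
    fix z
    assume "z \<in> (\<lambda>x. x - 1) ` cyc_class e"
    then show "z \<in> {z. z \<noteq> 0 \<and> z + 1 \<noteq> 0 \<and> dlog (z + 1) = e}"
      using e by (auto simp: cyc_class_def)
  qed
  also have "\<dots> = f"
    by (simp add: card_image card_cyc_class)
  \<comment> \<open>Positivity of \<open>f\<close> is essential: truncated subtraction would allow
    \<open>f - 1 = f\<close> at \<open>f = 0\<close>.\<close>
  finally show False
    using row f_pos c_commute by simp
qed

lemma dlog_minus [simp]: "dlog (- x) = dlog x"
proof (cases "x = 0")
  case False
  then show ?thesis
    using dlog_mult[of "-1" x] dlog_minus_1 by simp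
qed auto

text \<open>The substitution \<open>x = - (u * z)\<close> gives \<open>u - x = u * (z + 1)\<close>.
  The sign does not affect \<open>dlog\<close>, and the factor \<open>u\<close> shifts both indices
  by \<open>dlog u\<close>.\<close>

lemma card_sum_eq:
  assumes "u \<noteq> 0" "k \<in> residues" "l \<in> residues"
  shows "card {x. x \<noteq> 0 \<and> u - x \<noteq> 0 \<and> dlog x = k \<and> dlog (u - x) = l} =
    c (k - dlog u) (l - dlog u)"
proof -
  have shift: "dlog z = (k - dlog u) mod int m \<longleftrightarrow> dlog (u * z) = k"
    if "z \<noteq> 0" "k \<in> residues" for z k
    using that assms(1)
    by (metis add.commute diff_add_cancel dlog_mod dlog_mult mod_add_right_eq mod_diff_left_eq
        residues_mod add_diff_cancel_left')
  have "bij_betw (\<lambda>z. - (u * z))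
     {z. z \<noteq> 0 \<and> z + 1 \<noteq> 0 \<and> dlog z = (k - dlog u) mod int m \<and> dlog (z + 1) = (l - dlog u) mod int m}
     {x. x \<noteq> 0 \<and> u - x \<noteq> 0 \<and> dlog x = k \<and> dlog (u - x) = l}"
  proof (rule bij_betw_byWitness[where f' = "\<lambda>x. - (x / u)"])
    show "(\<lambda>z. - (u * z)) ` {z. z \<noteq> 0 \<and> z + 1 \<noteq> 0 \<and> dlog z = (k - dlog u) mod int m \<and>
        dlog (z + 1) = (l - dlog u) mod int m}
      \<subseteq> {x. x \<noteq> 0 \<and> u - x \<noteq> 0 \<and> dlog x = k \<and> dlog (u - x) = l}"
    proof (rule image_subsetI)
      fix z
      assume z: "z \<in> {z. z \<noteq> 0 \<and> z + 1 \<noteq> 0 \<and> dlog z = (k - dlog u) mod int m \<and>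
        dlog (z + 1) = (l - dlog u) mod int m}"
      have eq: "u + u * z = u * (z + 1)"
        by (simp add: algebra_simps)
      have "u \<noteq> - (u * z)"
        using eq z assms by (auto simp: eq_neg_iff_add_eq_0)
      then show "- (u * z) \<in> {x. x \<noteq> 0 \<and> u - x \<noteq> 0 \<and> dlog x = k \<and> dlog (u - x) = l}"
        using z shift[of z k] shift[of "z + 1" l] assms by (simp add: eq)
    qed
    show "(\<lambda>x. - (x / u)) ` {x. x \<noteq> 0 \<and> u - x \<noteq> 0 \<and> dlog x = k \<and> dlog (u - x) = l}
      \<subseteq> {z. z \<noteq> 0 \<and> z + 1 \<noteq> 0 \<and> dlog z = (k - dlog u) mod int m \<and>
        dlog (z + 1) = (l - dlog u) mod int m}"
    proof (rule image_subsetI)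
      fix x
      assume x: "x \<in> {x. x \<noteq> 0 \<and> u - x \<noteq> 0 \<and> dlog x = k \<and> dlog (u - x) = l}"
      have "1 - x / u = (u - x) / u"
        using assms by (simp add: field_simps)
      moreover have "(u - x) / u \<noteq> 0"
        using x assms by simp
      ultimately show "- (x / u) \<in> {z. z \<noteq> 0 \<and> z + 1 \<noteq> 0 \<and>
          dlog z = (k - dlog u) mod int m \<and> dlog (z + 1) = (l - dlog u) mod int m}"
        using x assms shift[of "x / u" k] shift[of "(u - x) / u" l] by simp
    qed
  qed (use assms in auto)
  then show ?thesis
    unfolding cyclotomic_number_alt by (simp add: bij_betw_same_card)
qed

text \<open>Substitute \<open>t = u / x - 1\<close>, which ranges over the class of \<open>1\<close> without \<open>-1\<close>.\<close>

lemma card_dlog_eq_dlog_diff: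
  assumes "u \<noteq> 0"
  shows "card {x. x \<noteq> 0 \<and> u - x \<noteq> 0 \<and> dlog (u - x) = dlog x} = f - 1"
proof -
  have "bij_betw (\<lambda>t. u / (1 + t)) (cyc_class 0 - {-1})
     {x. x \<noteq> 0 \<and> u - x \<noteq> 0 \<and> dlog (u - x) = dlog x}"
  proof (rule bij_betw_byWitness[where f' = "\<lambda>x. (u - x) / x"])
    show "(\<lambda>t. u / (1 + t)) ` (cyc_class 0 - {-1}) \<subseteq>
        {x. x \<noteq> 0 \<and> u - x \<noteq> 0 \<and> dlog (u - x) = dlog x}"
    proof clarsimp
      fix t
      assume t: "t \<in> cyc_class 0" "t \<noteq> - 1"
      then have nz: "1 + t \<noteq> 0"
        by (metis add.commute eq_neg_iff_add_eq_0)
      then have eq: "u - u / (1 + t) = u / (1 + t) * t"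
        by (simp add: field_simps)
      have "u \<noteq> u / (1 + t)"
        using t nz assms by (auto simp: cyc_class_def field_simps)
      then show "u \<noteq> 0 \<and> 1 + t \<noteq> 0 \<and> u \<noteq> u / (1 + t) \<and> dlog (u - u / (1 + t)) = dlog (u / (1 + t))"
        unfolding eq using t nz assms dlog_mult[of "u / (1 + t)" t] by (auto simp: cyc_class_def)
    qed
    show "(\<lambda>x. (u - x) / x) ` {x. x \<noteq> 0 \<and> u - x \<noteq> 0 \<and> dlog (u - x) = dlog x} \<subseteq>
        cyc_class 0 - {-1}"
    proof clarsimp
      fix x
      assume x: "x \<noteq> 0" "u \<noteq> x" "dlog (u - x) = dlog x"
      have "dlog (u - x) = (dlog ((u - x) / x) + dlog x) mod int m"
        using dlog_mult[of "(u - x) / x" x] x by simp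
      then have "[dlog ((u - x) / x) + dlog x = 0 + dlog x] (mod int m)"
        using x by (simp add: cong_def)
      then have "dlog ((u - x) / x) = 0"
        by (simp only: cong_add_rcancel residues_cong_iff dlog_in_residues zero_in_residues)
      then show "(u - x) / x \<in> cyc_class 0 \<and> (u - x) / x \<noteq> - 1"
        using x assms by (simp add: cyc_class_def divide_eq_eq)
    qed
    show "\<forall>t\<in>cyc_class 0 - {-1}. (u - u / (1 + t)) / (u / (1 + t)) = t"
    proof
      fix t
      assume "t \<in> cyc_class 0 - {-1}"
      then have nz: "1 + t \<noteq> 0"
        by (auto simp: add_eq_0_iff)
      then have "u - u / (1 + t) = u / (1 + t) * t"
        by (simp add: field_simps)
      then show "(u - u / (1 + t)) / (u / (1 + t)) = t"
        using nz assms by simp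
    qed
  qed (use assms in \<open>auto simp: field_simps\<close>)
  then have "card {x. x \<noteq> 0 \<and> u - x \<noteq> 0 \<and> dlog (u - x) = dlog x} = card (cyc_class 0 - {-1})"
    by (simp add: bij_betw_same_card)
  also have "\<dots> = f - 1"
    by (subst card_Diff_singleton) (simp_all add: card_cyc_class, simp add: cyc_class_def)
  finally show ?thesis .
qed

end

section \<open>Representation counts in an abelian group\<close>

text \<open>The convolution of two indicator functions, that is, the coefficient of \<open>g\<close>
  in the group-ring product of \<open>A\<close> and \<open>B\<close>.\<close>

definition rep_count :: "'g::ab_group_add set \<Rightarrow> 'g set \<Rightarrow> 'g \<Rightarrow> nat" where
  "rep_count A B g = card {a \<in> A. g - a \<in> B}"

lemma rep_count_commute: "rep_count A B g = rep_count B A g"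
proof -
  have "bij_betw (\<lambda>a. g - a) {a \<in> A. g - a \<in> B} {b \<in> B. g - b \<in> A}"
    by (rule bij_betw_byWitness[where f' = "\<lambda>a. g - a"]) auto
  then show ?thesis
    unfolding rep_count_def by (rule bij_betw_same_card)
qed

lemma rep_count_Un_left:
  fixes A :: "'g::{ab_group_add, finite} set"
  assumes "A \<inter> A' = {}"
  shows "rep_count (A \<union> A') B g = rep_count A B g + rep_count A' B g"
proof -
  have "{a \<in> A \<union> A'. g - a \<in> B} = {a \<in> A. g - a \<in> B} \<union> {a \<in> A'. g - a \<in> B}"
    by auto
  then show ?thesis
    unfolding rep_count_def using assms by (simp only:) (rule card_Un_disjoint, auto)
qed

text \<open>A binomial expansion: the two mixed terms agree because the group is
  commutative.\<close>

lemma rep_count_Un_Un: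
  fixes A :: "'g::{ab_group_add, finite} set"
  assumes "A \<inter> B = {}"
  shows "rep_count (A \<union> B) (A \<union> B) g = rep_count A A g + 2 * rep_count A B g + rep_count B B g"
proof -
  have "rep_count A (A \<union> B) g = rep_count A A g + rep_count A B g"
    "rep_count B (A \<union> B) g = rep_count A B g + rep_count B B g"
    using rep_count_Un_left[OF assms, of A g] rep_count_Un_left[OF assms, of B g]
    by (simp_all add: rep_count_commute[of _ "A \<union> B"] rep_count_commute[of B A])
  then show ?thesis
    by (simp add: rep_count_Un_left[OF assms])
qed

text \<open>Each pair in \<open>A \<times> B\<close> is counted once, at the sum of its
  components.\<close>

lemma sum_rep_count:
  fixes A :: "'g::{ab_group_add, finite} set"
  shows "(\<Sum>g\<in>UNIV. rep_count A B g) = card A * card B"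
proof -
  have "card (A \<times> B) = (\<Sum>g\<in>UNIV. card {p \<in> A \<times> B. fst p + snd p = g})"
    by (rule card_sum_fibres) auto
  also have "\<dots> = (\<Sum>g\<in>UNIV. rep_count A B g)"
  proof (rule sum.cong[OF refl])
    fix g :: 'g
    have "bij_betw (\<lambda>a. (a, g - a)) {a \<in> A. g - a \<in> B} {p \<in> A \<times> B. fst p + snd p = g}"
      by (rule bij_betw_byWitness[where f' = fst]) auto
    then show "card {p \<in> A \<times> B. fst p + snd p = g} = rep_count A B g"
      by (simp add: rep_count_def bij_betw_same_card)
  qed
  finally show ?thesis
    by (simp add: card_cartesian_product)
qed

section \<open>Invariance under permutations of the residues\<close>

text \<open>By \<open>c_cases\<close> the value depends only on the coincidences among
  \<open>a\<close>, \<open>k\<close> and \<open>l\<close>, and an injection preserves these.\<close>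

lemma (in uniform_cyclotomy) c_inj_on:
  assumes "inj_on \<tau> residues" "\<tau> ` residues \<subseteq> residues"
    and "a \<in> residues" "k \<in> residues" "l \<in> residues"
  shows "c (\<tau> k - \<tau> a) (\<tau> l - \<tau> a) = c (k - a) (l - a)"
proof -
  have cong_diff: "[x - z = y - z] (mod int m) \<longleftrightarrow> [x = y] (mod int m)" for x y z :: int
    by (simp add: cong_iff_dvd_diff)
  have cong_0: "[x - z = 0] (mod int m) \<longleftrightarrow> [x = z] (mod int m)" for x z :: int
    by (simp add: cong_iff_dvd_diff)
  have iff: "[\<tau> x = \<tau> y] (mod int m) \<longleftrightarrow> [x = y] (mod int m)" if "x \<in> residues" "y \<in> residues" for x y
    using that assms(1,2) by (metis image_subset_iff inj_on_eq_iff residues_cong_iff)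
  show ?thesis
    using assms(3-5)
    by (subst (1 2) c_cases) (simp only: cong_diff cong_0 iff)
qed

text \<open>One transposition moves \<open>a\<close> to \<open>a'\<close>; a second moves the image
  of \<open>b\<close> to \<open>b'\<close> and fixes \<open>a'\<close>, which differs from
  both.\<close>

lemma ex_permutation_two_points:
  assumes "a \<in> A" "b \<in> A" "a' \<in> A" "b' \<in> A" "a \<noteq> b" "a' \<noteq> b'"
  obtains \<tau> where "bij_betw \<tau> A A" "\<tau> a = a'" "\<tau> b = b'"
proof -
  define t where "t = transpose a a'"
  have "bij_betw t A A"
    using assms by (simp add: t_def)
  moreover have "t b \<in> A"
    using assms by (auto simp: t_def transpose_def)
  then have "bij_betw (transpose (t b) b') A A"
    using assms by simp
  ultimately have "bij_betw (transpose (t b) b' \<circ> t) A A"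
    by (rule bij_betw_trans)
  moreover have "t a = a'" "t b \<noteq> a'"
    using assms by (auto simp: t_def transpose_def)
  then have "(transpose (t b) b' \<circ> t) a = a'" "(transpose (t b) b' \<circ> t) b = b'"
    using assms by auto
  ultimately show ?thesis
    using that by blast
qed

text \<open>\<open>E\<close>, \<open>D\<close> and \<open>R\<close> below stand for \<open>C\<^sub>1\<close>, \<open>D\<^sub>0\<close> and the union of the other \<open>D\<^sub>i\<close>.\<close>

locale uniform_cyclotomy_pair =
  F1: uniform_cyclotomy m \<alpha>1 + F2: uniform_cyclotomy m \<alpha>2
  for m :: nat and \<alpha>1 :: "'a::{field,finite}" and \<alpha>2 :: "'b::{field,finite}"
begin

section \<open>The blocks of the group and their sizes\<close>

definition E :: "('a \<times> 'b) set" where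
  "E = {(x, y). x \<noteq> 0 \<and> y = 0}"

definition D :: "('a \<times> 'b) set" where
  "D = {(x, y). x \<noteq> 0 \<and> y \<noteq> 0 \<and> F1.dlog x = F2.dlog y}"

definition R :: "('a \<times> 'b) set" where
  "R = {(x, y). x \<noteq> 0 \<and> y \<noteq> 0 \<and> F1.dlog x \<noteq> F2.dlog y}"

abbreviation S :: "('a \<times> 'b) set" where
  "S \<equiv> E \<union> D"

abbreviation N :: "'a \<times> 'b \<Rightarrow> nat" where
  "N \<equiv> rep_count S S"

lemma C1_set_eq: "C1_set \<alpha>1 = E"
proof -
  \<comment> \<open>This makes \<open>k < CARD('a) - 1\<close> and
    \<open>k \<le> CARD('a) - 2\<close> equivalent despite truncated subtraction.\<close>
  have "CARD('a) - 1 > 0"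
    using F1.card_gt_1 by simp
  then have "\<exists>k\<le>CARD('a) - 2. x = \<alpha>1 ^ k" if "x \<noteq> 0" for x
    using F1.nonzero_eq_power_less[OF _ F1.power_card_minus_1 that]
    by (metis One_nat_def Suc_1 diff_Suc_eq_diff_pred less_Suc_eq_le Suc_pred)
  then show ?thesis
    by (auto simp: C1_set_def E_def)
qed

lemma D_set_eq: "D_set m 0 \<alpha>1 \<alpha>2 = D"
proof (intro equalityI subsetI)
  fix p
  assume "p \<in> D_set m 0 \<alpha>1 \<alpha>2"
  then show "p \<in> D"
    by (auto simp: D_set_def D_def cong_iff_dvd_diff mod_eq_dvd_iff)
next
  fix p
  assume p: "p \<in> D"
  then obtain k l where kl: "\<alpha>1 powi k = fst p" "\<alpha>2 powi l = snd p"
    using F1.nonzero_powi F2.nonzero_powi by (fastforce simp: D_def)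
  with p have "k mod int m = l mod int m"
    by (auto simp: D_def)
  then have "[k - l = 0] (mod int m)"
    by (simp add: cong_iff_dvd_diff mod_eq_dvd_iff)
  with kl show "p \<in> D_set m 0 \<alpha>1 \<alpha>2"
    unfolding D_set_def by (cases p) auto
qed

text \<open>For \<open>D\<close> this rests on \<open>dlog_minus\<close> in both fields.\<close>

lemma S_uminus: "- s \<in> S \<longleftrightarrow> s \<in> S"
  by (auto simp: E_def D_def)

lemma zero_notin_S: "0 \<notin> S"
  by (auto simp: E_def D_def zero_prod_def)

lemma zero_fst_notin_D: "(0, v) \<notin> D"
  by (simp add: D_def)

lemma E_D_disjoint: "E \<inter> D = {}"
  by (auto simp: E_def D_def)

lemmas N_eq = rep_count_Un_Un[OF E_D_disjoint]

lemma card_E: "card E = m * F1.f"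
proof -
  have E: "E = (UNIV - {0}) \<times> {0}"
    by (auto simp: E_def)
  show ?thesis
    unfolding E using F1.card_eq by (simp add: card_cartesian_product)
qed

lemma card_D: "card D = m * F1.f * F2.f"
proof -
  have "D = (SIGMA x:UNIV - {0}. F2.cyc_class (F1.dlog x))"
    by (auto simp: D_def F2.cyc_class_def)
  then show ?thesis
    using F1.card_eq by (simp add: F2.card_cyc_class)
qed

text \<open>Kept additive so that the later passage to integers meets no truncated
  subtraction.\<close>

lemma card_R: "card R + m * F1.f * F2.f = m * F1.f * (m * F2.f)"
proof -
  have "card R + card D = card (R \<union> D)"
    by (rule card_Un_disjoint[symmetric]) (auto simp: R_def D_def)
  also have "R \<union> D = (UNIV - {0}) \<times> (UNIV - {0})"
    by (auto simp: R_def D_def)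
  finally show ?thesis
    using F1.card_eq F2.card_eq by (simp add: card_cartesian_product card_D)
qed

section \<open>Representation counts between the blocks\<close>

lemma rep_E_E_fst: "u \<noteq> 0 \<Longrightarrow> rep_count E E (u, 0) = m * F1.f - 1"
proof -
  assume u: "u \<noteq> 0"
  have "{a \<in> E. (u, 0) - a \<in> E} = (UNIV - {0, u}) \<times> {0}"
    by (auto simp: E_def zero_prod_def)
  then have "rep_count E E (u, 0) = CARD('a) - card {0, u}"
    by (simp add: rep_count_def card_cartesian_product card_Diff_subset)
  then show ?thesis
    using F1.card_eq u by simp
qed

lemma rep_E_E_snd: "v \<noteq> 0 \<Longrightarrow> rep_count E E (u, v) = 0"
  by (auto simp: rep_count_def E_def)

lemma rep_E_D_fst: "rep_count E D (u, 0) = 0"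
  by (auto simp: rep_count_def E_def D_def)

text \<open>The summand from \<open>D\<close> has second coordinate \<open>v\<close>, so its first
  coordinate \<open>x\<close> runs through the class of \<open>v\<close>. The summand
  \<open>(u - x, 0)\<close> would fall outside \<open>E\<close> only for \<open>x = u\<close>, which
  \<open>(u, v) \<notin> D\<close> excludes.\<close>

lemma rep_E_D_snd:
  assumes "v \<noteq> 0" "(u, v) \<notin> D"
  shows "rep_count E D (u, v) = F1.f"
proof -
  have "bij_betw (\<lambda>x. (u - x, 0)) (F1.cyc_class (F2.dlog v)) {a \<in> E. (u, v) - a \<in> D}"
    by (rule bij_betw_byWitness[where f' = "\<lambda>a. u - fst a"])
       (use assms in \<open>auto simp: E_def D_def F1.cyc_class_def\<close>)
  then show ?thesis
    by (simp add: rep_count_def F1.card_cyc_class flip: bij_betw_same_card)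
qed

text \<open>The second coordinates are \<open>y\<close> and \<open>- y\<close>, which lie in the
  same class. So \<open>x\<close> and \<open>u - x\<close> must share a class, and \<open>y\<close>
  then runs freely through it.\<close>

lemma rep_D_D_fst:
  assumes "u \<noteq> 0"
  shows "rep_count D D (u, 0) = (F1.f - 1) * F2.f"
proof -
  have "{a \<in> D. (u, 0) - a \<in> D} =
      (SIGMA x:{x. x \<noteq> 0 \<and> u - x \<noteq> 0 \<and> F1.dlog (u - x) = F1.dlog x}. F2.cyc_class (F1.dlog x))"
    by (auto simp: D_def F2.cyc_class_def)
  then show ?thesis
    using F1.card_dlog_eq_dlog_diff[OF assms] by (simp add: rep_count_def F2.card_cyc_class)
qed

text \<open>The mirror image of \<open>rep_D_D_fst\<close>; the swap lets the pairs be fibred over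
  the second coordinate.\<close>

lemma rep_D_D_snd:
  assumes "v \<noteq> 0"
  shows "rep_count D D (0, v) = (F2.f - 1) * F1.f"
proof -
  have "bij_betw prod.swap {a \<in> D. (0, v) - a \<in> D}
      (SIGMA y:{y. y \<noteq> 0 \<and> v - y \<noteq> 0 \<and> F2.dlog (v - y) = F2.dlog y}. F1.cyc_class (F2.dlog y))"
    by (rule bij_betw_byWitness[where f' = prod.swap]) (auto simp: D_def F1.cyc_class_def)
  then show ?thesis
    using F2.card_dlog_eq_dlog_diff[OF assms]
    by (simp add: rep_count_def F1.card_cyc_class bij_betw_same_card)
qed

text \<open>The decompositions are sorted by the classes \<open>k\<close> and \<open>l\<close> of
  the two summands. Membership in \<open>D\<close> imposes the same classes on both coordinates, so
  the count for fixed \<open>k\<close> and \<open>l\<close> is a product over the two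
  fields.\<close>

lemma rep_D_D_sum:
  assumes "u \<noteq> 0" "v \<noteq> 0"
  shows "rep_count D D (u, v) = (\<Sum>(k, l)\<in>F1.residues \<times> F1.residues.
    F1.c (k - F1.dlog u) (l - F1.dlog u) * F2.c (k - F2.dlog v) (l - F2.dlog v))"
proof -
  let ?f = "\<lambda>p. (F1.dlog (fst p), F1.dlog (u - fst p))"
  have "card {a \<in> D. (u, v) - a \<in> D} =
      (\<Sum>kl\<in>F1.residues \<times> F1.residues. card {p \<in> {a \<in> D. (u, v) - a \<in> D}. ?f p = kl})"
    by (rule card_sum_fibres) auto
  also have "\<dots> = (\<Sum>(k, l)\<in>F1.residues \<times> F1.residues.
    F1.c (k - F1.dlog u) (l - F1.dlog u) * F2.c (k - F2.dlog v) (l - F2.dlog v))"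
  proof (rule sum.cong[OF refl], clarify)
    fix k l
    assume kl: "k \<in> F1.residues" "l \<in> F1.residues"
    have "{p \<in> {a \<in> D. (u, v) - a \<in> D}. ?f p = (k, l)} =
        {x. x \<noteq> 0 \<and> u - x \<noteq> 0 \<and> F1.dlog x = k \<and> F1.dlog (u - x) = l} \<times>
        {y. y \<noteq> 0 \<and> v - y \<noteq> 0 \<and> F2.dlog y = k \<and> F2.dlog (v - y) = l}"
      by (auto simp: D_def)
    then show "card {p \<in> {a \<in> D. (u, v) - a \<in> D}. ?f p = (k, l)} =
        F1.c (k - F1.dlog u) (l - F1.dlog u) * F2.c (k - F2.dlog v) (l - F2.dlog v)"
      by (simp only: card_cartesian_product F1.card_sum_eq[OF assms(1) kl]
          F2.card_sum_eq[OF assms(2) kl])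
  qed
  finally show ?thesis
    by (simp add: rep_count_def)
qed

text \<open>Uniformity makes the summands of \<open>rep_D_D_sum\<close> depend only on which of \<open>k\<close>, \<open>l\<close>,
  \<open>dlog u\<close>, \<open>dlog v\<close> coincide, so a permutation of the residues transports one sum to the other.\<close>

lemma rep_D_D_const:
  assumes "(u, v) \<in> R" "(u', v') \<in> R"
  shows "rep_count D D (u, v) = rep_count D D (u', v')"
proof -
  let ?I = "F1.residues"
  obtain \<tau> where \<tau>: "bij_betw \<tau> ?I ?I"
    "\<tau> (F1.dlog u) = F1.dlog u'" "\<tau> (F2.dlog v) = F2.dlog v'"
    by (rule ex_permutation_two_points[of "F1.dlog u" ?I "F2.dlog v" "F1.dlog u'" "F2.dlog v'"])
       (use assms in \<open>auto simp: R_def\<close>)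
  then have \<tau>_on: "inj_on \<tau> ?I" "\<tau> ` ?I \<subseteq> ?I"
    by (auto simp: bij_betw_def)
  have "rep_count D D (u', v') = (\<Sum>(k, l)\<in>?I \<times> ?I.
      F1.c (k - F1.dlog u') (l - F1.dlog u') * F2.c (k - F2.dlog v') (l - F2.dlog v'))"
    using assms by (intro rep_D_D_sum) (auto simp: R_def)
  also have "\<dots> = (\<Sum>(k, l)\<in>?I \<times> ?I.
      F1.c (\<tau> k - F1.dlog u') (\<tau> l - F1.dlog u') * F2.c (\<tau> k - F2.dlog v') (\<tau> l - F2.dlog v'))"
    by (subst sum.reindex_bij_betw[OF bij_betw_map_prod[OF \<tau>(1) \<tau>(1)], symmetric])
       (simp add: case_prod_unfold)
  also have "\<dots> = (\<Sum>(k, l)\<in>?I \<times> ?I.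
      F1.c (k - F1.dlog u) (l - F1.dlog u) * F2.c (k - F2.dlog v) (l - F2.dlog v))"
    unfolding \<tau>(2,3)[symmetric]
    by (intro sum.cong refl) (auto simp: F1.c_inj_on[OF \<tau>_on] F2.c_inj_on[OF \<tau>_on])
  also have "\<dots> = rep_count D D (u, v)"
    using assms by (intro rep_D_D_sum[symmetric]) (auto simp: R_def)
  finally show ?thesis ..
qed

section \<open>The values of \<open>N\<close> on the blocks\<close>

lemma N_E: "u \<noteq> 0 \<Longrightarrow> N (u, 0) = m * F1.f - 1 + (F1.f - 1) * F2.f"
  by (simp add: N_eq rep_E_E_fst rep_E_D_fst rep_D_D_fst)

text \<open>The three terms of \<open>N_eq\<close> are \<open>0\<close>, \<open>2 * F1.f\<close> and
  \<open>(F2.f - 1) * F1.f\<close>; since \<open>F2.f > 0\<close>, the subtraction is exact.\<close>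

lemma N_snd: "v \<noteq> 0 \<Longrightarrow> N (0, v) = F1.f * (F2.f + 1)"
  using F2.f_pos rep_E_D_snd[of v 0]
  by (cases F2.f) (auto simp: N_eq rep_E_E_snd rep_D_D_snd zero_fst_notin_D)

lemma N_0: "N 0 = card S"
  unfolding rep_count_def by (rule arg_cong[where f = card]) (auto simp: S_uminus simp del: Un_iff)

lemma N_R_const: "g \<in> R \<Longrightarrow> g' \<in> R \<Longrightarrow> N g = N g'"
proof (cases g; cases g')
  fix u v u' v'
  assume g: "g \<in> R" "g' \<in> R" "g = (u, v)" "g' = (u', v')"
  then have "v \<noteq> 0" "v' \<noteq> 0" "(u, v) \<notin> D" "(u', v') \<notin> D"
    by (auto simp: R_def D_def)
  then show ?thesis
    using g rep_D_D_const[of u v u' v'] by (simp add: N_eq rep_E_E_snd rep_E_D_snd)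
qed

lemma N_R:
  assumes S: "\<And>s. s \<in> S \<Longrightarrow> N s = l" and g: "g \<in> R"
  shows "N g = F1.f * (F2.f + 1)"
proof -
  let ?V = "{0} \<times> (UNIV - {0}) :: ('a \<times> 'b) set"
  have one_in_E: "(1, 0) \<in> E"
    by (simp add: E_def)
  \<comment> \<open>The point \<open>(1, 0)\<close> of \<open>E\<close> determines the constant
    value of \<open>N\<close> on \<open>S\<close>.\<close>
  have l: "l = m * F1.f - 1 + (F1.f - 1) * F2.f"
    using S[of "(1, 0)"] N_E[of 1] one_in_E by (simp only: UnI1 one_neq_zero not_False_eq_True)
  have "(UNIV :: ('a \<times> 'b) set) = {0} \<union> S \<union> ?V \<union> R"
    by (auto simp: E_def D_def R_def zero_prod_def)
  then have "(\<Sum>g\<in>UNIV. N g) = (\<Sum>g\<in>{0} \<union> S \<union> ?V \<union> R. N g)"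
    by simp
  also have "\<dots> = (\<Sum>g\<in>{0}. N g) + (\<Sum>g\<in>S. N g) + (\<Sum>g\<in>?V. N g) + (\<Sum>g\<in>R. N g)"
  proof -
    have "{0} \<inter> S = {}" "({0} \<union> S) \<inter> ?V = {}" "({0} \<union> S \<union> ?V) \<inter> R = {}"
      by (auto simp: E_def D_def R_def zero_prod_def)
    then show ?thesis
      by (simp only: sum.union_disjoint finite)
  qed
  also have "(\<Sum>g\<in>S. N g) = card S * l"
    using S by simp
  also have "(\<Sum>g\<in>?V. N g) = (\<Sum>g\<in>?V. F1.f * (F2.f + 1))"
  proof (rule sum.cong[OF refl])
    fix h :: "'a \<times> 'b"
    assume "h \<in> ?V"
    then obtain v where "h = (0, v)" "v \<noteq> 0"
      by auto
    then show "N h = F1.f * (F2.f + 1)"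
      by (simp only: N_snd not_False_eq_True)
  qed
  also have "\<dots> = m * F2.f * (F1.f * (F2.f + 1))"
    using F2.card_eq by (simp add: card_cartesian_product)
  also have "(\<Sum>h\<in>R. N h) = (\<Sum>h\<in>R. N g)"
    by (rule sum.cong[OF refl], rule N_R_const[OF _ g])
  finally have sum: "card S * card S =
      card S + card S * l + m * F2.f * (F1.f * (F2.f + 1)) + card R * N g"
    by (simp add: sum_rep_count N_0)
  have card_S: "card S = m * F1.f + m * F1.f * F2.f"
    using E_D_disjoint by (simp add: card_Un_disjoint card_E card_D)
  \<comment> \<open>Over the integers the subtractions are exact. Removing the other blocks from
    \<open>card S ^ 2\<close> leaves \<open>m * F1.f * F2.f * (m - 1)\<close>, which is
    \<open>card R\<close>, times \<open>F1.f * (F2.f + 1)\<close>.\<close>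
  have "int (card R) * int (N g) = int (card R) * int (F1.f * (F2.f + 1))"
  proof -
    have "int (card S) * int (card S) = int (card S) + int (card S) * int l
        + int m * int F2.f * (int F1.f * (int F2.f + 1)) + int (card R) * int (N g)"
      using arg_cong[OF sum, of int] by (simp only: of_nat_add of_nat_mult of_nat_1)
    moreover have "int (card S) = int m * int F1.f + int m * int F1.f * int F2.f"
      using card_S by (simp only: of_nat_add of_nat_mult)
    moreover have "int l = int m * int F1.f - 1 + (int F1.f - 1) * int F2.f"
      unfolding l using F1.f_pos F1.m_ge_2
      by (simp add: of_nat_diff Suc_le_eq)
    moreover have "int (card R) + int m * int F1.f * int F2.f = int m * int F1.f * (int m * int F2.f)"
      using arg_cong[OF card_R, of int] by (simp only: of_nat_add of_nat_mult)
    ultimately have "int (card R) * int (N g) = int (card R) * (int F1.f * (int F2.f + 1))"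
      by algebra
    then show ?thesis
      by (simp only: of_nat_add of_nat_mult of_nat_1)
  qed
  \<comment> \<open>The point \<open>g\<close> itself makes \<open>R\<close> nonempty, so the factor
    cancels.\<close>
  moreover have "card R \<noteq> 0"
    using g by auto
  ultimately show ?thesis
    by (simp only: mult_cancel_left of_nat_eq_iff of_nat_eq_0_iff simp_thms)
qed

lemma N_nonadjacent:
  assumes "\<And>s. s \<in> S \<Longrightarrow> N s = l" "g \<noteq> 0" "g \<notin> S"
  shows "N g = F1.f * (F2.f + 1)"
proof (cases "g \<in> R")
  case True
  then show ?thesis
    by (intro N_R[of l] assms(1))
next
  case False
  then obtain v where "g = (0, v)" "v \<noteq> 0"
    using assms(2,3) by (cases g) (auto simp: E_def D_def R_def zero_prod_def)
  then show ?thesis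
    by (simp add: N_snd)
qed

end

section \<open>Triangles and common neighbours in Cayley graphs\<close>

lemma cayley_dominates_iff: "u \<rightarrow>\<^bsub>with_proj (cayley_digraph S)\<^esub> v \<longleftrightarrow> v - u \<in> S"
  by (auto simp: cayley_digraph_def) (metis diff_add_cancel)

text \<open>The third vertex \<open>w\<close> of a triangle on \<open>0\<close> and \<open>g\<close>
  gives the decomposition of \<open>g\<close> into \<open>w\<close> and \<open>g - w\<close>. Arcs
  starting at \<open>0\<close> suffice, as they reach every element of \<open>S\<close>.\<close>

lemma cayley_card_triangles:
  fixes S :: "'g::{ab_group_add, finite} set"
  assumes uminus: "\<And>s. - s \<in> S \<longleftrightarrow> s \<in> S" and zero: "0 \<notin> S" and g: "g \<in> S"
  shows "card {T. clique (with_proj (cayley_digraph S)) T \<and> card T = 3 \<and> 0 \<in> T \<and> g \<in> T} =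
    rep_count S S g"
proof -
  let ?T = "{T. clique (with_proj (cayley_digraph S)) T \<and> card T = 3 \<and> 0 \<in> T \<and> g \<in> T}"
  have flip: "a - b \<in> S \<longleftrightarrow> b - a \<in> S" for a b
    using uminus[of "a - b"] by simp
  have g0: "g \<noteq> 0"
    using g zero by auto
  have clique_iff: "clique (with_proj (cayley_digraph S)) T \<longleftrightarrow>
      (\<forall>u\<in>T. \<forall>v\<in>T. u \<noteq> v \<longrightarrow> v - u \<in> S)" for T
    by (simp only: clique_def cayley_dominates_iff) (simp add: cayley_digraph_def)
  have "bij_betw (\<lambda>w. {0, g, w}) {s \<in> S. g - s \<in> S} ?T"
  proof (rule bij_betwI')
    fix x y
    assume "x \<in> {s \<in> S. g - s \<in> S}" "y \<in> {s \<in> S. g - s \<in> S}"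
    \<comment> \<open>Either equality would put \<open>0\<close> into \<open>S\<close>; so the third
      vertex is new and is recovered from the triangle.\<close>
    then have "x \<noteq> 0" "x \<noteq> g" "y \<noteq> 0" "y \<noteq> g"
      using zero by auto
    then show "{0, g, x} = {0, g, y} \<longleftrightarrow> x = y"
      by auto
  next
    fix x
    assume x: "x \<in> {s \<in> S. g - s \<in> S}"
    then have "x \<noteq> 0" "x \<noteq> g"
      using zero by auto
    moreover have "x \<in> S" "g - x \<in> S" "x - g \<in> S" "- x \<in> S" "- g \<in> S"
      using x g by (simp_all add: uminus flip[of x g])
    ultimately show "{0, g, x} \<in> ?T"
      using g g0 by (simp add: clique_iff)
  next
    fix T
    assume T: "T \<in> ?T"
    then have "card (T - {0, g}) = 1"
      using g0 by (simp add: card_Diff_subset)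
    then obtain w where "T - {0, g} = {w}"
      by (auto simp: card_1_singleton_iff)
    moreover from T have "{0, g} \<subseteq> T"
      by simp
    ultimately have w: "w \<noteq> 0" "w \<noteq> g" "T = {0, g, w}"
      by blast+
    from T have "\<forall>u\<in>T. \<forall>v\<in>T. u \<noteq> v \<longrightarrow> v - u \<in> S"
      by (simp add: clique_iff)
    then have "w - 0 \<in> S" "g - w \<in> S"
      using w by (metis insertCI)+
    then show "\<exists>x\<in>{s \<in> S. g - s \<in> S}. T = {0, g, x}"
      using w(3) by (intro bexI[of _ w]) simp_all
  qed
  then show ?thesis
    by (simp add: rep_count_def bij_betw_same_card)
qed

text \<open>Translation by \<open>- u\<close> moves the pair to \<open>0\<close> and
  \<open>v - u\<close>; the symmetry of \<open>S\<close> reverses \<open>w - v\<close>.\<close>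

lemma cayley_card_common_neighbours:
  fixes S :: "'g::{ab_group_add, finite} set"
  assumes uminus: "\<And>s. - s \<in> S \<longleftrightarrow> s \<in> S"
  shows "card {w. w - u \<in> S \<and> w - v \<in> S} = rep_count S S (v - u)"
proof -
  have flip: "a - b \<in> S \<longleftrightarrow> b - a \<in> S" for a b
    using uminus[of "a - b"] by simp
  have "bij_betw (\<lambda>w. w - u) {w. w - u \<in> S \<and> w - v \<in> S} {s \<in> S. v - u - s \<in> S}"
    by (rule bij_betw_byWitness[where f' = "\<lambda>s. s + u"])
       (auto simp: flip[of _ v] algebra_simps)
  then show ?thesis
    by (simp add: rep_count_def bij_betw_same_card)
qed

theorem theorem3p13:
  fixes m :: nat and \<alpha>1 :: "'a::{field,finite}" and \<alpha>2 :: "'b::{field,finite}"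
  assumes "m \<ge> 2"
    and "[CARD('a) = 1] (mod m)" and "[CARD('b) = 1] (mod m)"
    and "primitive_element \<alpha>1" and "primitive_element \<alpha>2"
    and "neumaier_graph (with_proj (Gamma_graph m \<alpha>1 \<alpha>2))"
    and "uniform_cyclotomic m \<alpha>1" and "uniform_cyclotomic m \<alpha>2"
  shows "strongly_regular (with_proj (Gamma_graph m \<alpha>1 \<alpha>2))"
proof -
  interpret uniform_cyclotomy_pair m \<alpha>1 \<alpha>2
    using assms by unfold_locales
  let ?G = "with_proj (cayley_digraph S)"
  have G: "Gamma_graph m \<alpha>1 \<alpha>2 = cayley_digraph S"
    by (simp add: Gamma_graph_def C1_set_eq D_set_eq)
  have regular: "edge_regular ?G"
    using assms(6) by (simp add: neumaier_graph_def G)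
  then have "\<exists>l. \<forall>u v. u \<rightarrow>\<^bsub>?G\<^esub> v \<longrightarrow>
      card {T. clique ?G T \<and> card T = 3 \<and> u \<in> T \<and> v \<in> T} = l"
    by (simp only: edge_regular_def)
  then obtain l where triangles: "\<forall>u v. u \<rightarrow>\<^bsub>?G\<^esub> v \<longrightarrow>
      card {T. clique ?G T \<and> card T = 3 \<and> u \<in> T \<and> v \<in> T} = l" ..
  \<comment> \<open>The arc from \<open>0\<close> to \<open>s\<close> turns the triangle constant
    into the value of \<open>N\<close> at \<open>s\<close>.\<close>
  have l: "N s = l" if "s \<in> S" for s
  proof -
    have "0 \<rightarrow>\<^bsub>?G\<^esub> s"
      using that by (simp only: cayley_dominates_iff diff_zero)
    with triangles have "card {T. clique ?G T \<and> card T = 3 \<and> 0 \<in> T \<and> s \<in> T} = l"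
      by (elim allE impE)
    then show ?thesis
      by (simp only: cayley_card_triangles[OF S_uminus zero_notin_S that])
  qed
  have "card {w \<in> verts ?G. u \<rightarrow>\<^bsub>?G\<^esub> w \<and> v \<rightarrow>\<^bsub>?G\<^esub> w} = F1.f * (F2.f + 1)"
    if "u \<noteq> v" "\<not> u \<rightarrow>\<^bsub>?G\<^esub> v" for u v
  proof -
    have "card {w \<in> verts ?G. u \<rightarrow>\<^bsub>?G\<^esub> w \<and> v \<rightarrow>\<^bsub>?G\<^esub> w} = N (v - u)"
      unfolding cayley_dominates_iff
      using cayley_card_common_neighbours[OF S_uminus, of u v]
      by (simp only: cayley_digraph_def with_proj_simps pair_pre_digraph.simps UNIV_I simp_thms)
    also have "\<dots> = F1.f * (F2.f + 1)"
    proof (intro N_nonadjacent[of l] l)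
      show "v - u \<noteq> 0" "v - u \<notin> S"
        using that by (simp_all only: cayley_dominates_iff right_minus_eq not_sym not_False_eq_True)
    qed
    finally show ?thesis .
  qed
  then have "\<forall>u\<in>verts ?G. \<forall>v\<in>verts ?G. u \<noteq> v \<and> \<not> u \<rightarrow>\<^bsub>?G\<^esub> v \<longrightarrow>
      card {w \<in> verts ?G. u \<rightarrow>\<^bsub>?G\<^esub> w \<and> v \<rightarrow>\<^bsub>?G\<^esub> w} = F1.f * (F2.f + 1)"
    by (intro ballI impI) (elim conjE)
  then show ?thesis
    unfolding G strongly_regular_def by (intro conjI exI regular)
qed

end
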